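(* Let $G$ be a connected graph with vertex set $\{\mathbf{1},\mathbf{2},\dots,\mathbf{n}\}$, $n\ge 2$, let $\Phi=(F_1,F_2,\dots,F_n)$ be an ordered $n$-tuple of pairwise disjoint graphs such that for all $k\in\{1,\dots,n\}$ the graph $F_k$ is complete with $|V(F_k)|\ge 2$, and let $G[\Phi]$ be the generalized lexicographic product of $G$ and $\Phi$. Let $s\ge 1$ be an integer. Then $G[\Phi]$ is $\overline{K_s}$-$\gamma$-excellent if and only if $G$ is $\overline{K_s}$-$\gamma$-excellent.
   Context: All graphs are finite, simple, undirected. $\overline{K_s}$ is the edgeless graph on $s$ vertices. $\gamma(X)$ denotes the domination number of a graph $X$, and a $\gamma$-set of $X$ is a dominating set of cardinality $\gamma(X)$. Generalized lexicographic product: for a graph $G$ with $V(G)=\{\mathbf{1},\dots,\mathbf{n}\}$ and pairwise disjoint graphs $\Phi=(F_1,\dots,F_n)$, $G[\Phi]$ is the graph with vertex set $\bigcup_{i=1}^n V(F_i)$ such that each $F_i$ is an induced subgraph of $G[\Phi]$, and for $x\in V(F_i)$, $y\in V(F_j)$ with $i\ne j$, $xy$ is an edge of $G[\Phi]$ if and only if $\mathbf{i}\mathbf{j}\in E(G)$. For a graph $H$, a graph $X$ is $H$-$\gamma$-excellent if (i) for each $x\in V(X)$ there is an induced subgraph $H_x$ of $X$ isomorphic to $H$ with $x\in V(H_x)$ and $V(H_x)$ contained in some $\gamma$-set of $X$; and (ii) for each induced subgraph $H'$ of $X$ isomorphic to $H$ there is a $\gamma$-set of $X$ containing $V(H')$.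 *)

theory Defs
  imports "Graph_Theory.Graph_Theory" "HOL-Library.Disjoint_Sets"
begin

text \<open>
  A finite simple undirected graph is a \<^locale>\<open>pair_graph\<close>: an edge \<open>uv\<close> is the
  pair of arcs \<open>(u, v)\<close> and \<open>(v, u)\<close>.  Library notions for general digraphs (induced subgraph,
  isomorphism, connectedness, completeness) apply through the coercion \<^const>\<open>with_proj\<close>.
\<close>

definition edgeless_graph :: "nat \<Rightarrow> nat pair_pre_digraph" where
  "edgeless_graph s = \<lparr>pverts = {1..s}, parcs = {}\<rparr>"

definition dominating_set :: "'a pair_pre_digraph \<Rightarrow> 'a set \<Rightarrow> bool" where
  "dominating_set X D \<longleftrightarrow>
     D \<subseteq> pverts X \<and> (\<forall>v \<in> pverts X - D. \<exists>u \<in> D. (u, v) \<in> parcs X)"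

text \<open>The next two definitions are meant for finite \<open>X\<close>, since \<^const>\<open>card\<close> is \<open>0\<close> on infinite
  sets.\<close>

definition domination_number :: "'a pair_pre_digraph \<Rightarrow> nat" where
  "domination_number X = (LEAST k. \<exists>D. dominating_set X D \<and> card D = k)"

definition gamma_set :: "'a pair_pre_digraph \<Rightarrow> 'a set \<Rightarrow> bool" where
  "gamma_set X D \<longleftrightarrow> dominating_set X D \<and> card D = domination_number X"

text \<open>The arcs between different factors, together with disjointness of the factors and the
  absence of loops in \<open>G\<close>, leave each factor induced; see \<open>induced_subgraph_gen_lex_product\<close>.\<close>

definition gen_lex_product ::
    "'i pair_pre_digraph \<Rightarrow> ('i \<Rightarrow> 'a pair_pre_digraph) \<Rightarrow> 'a pair_pre_digraph" where
  "gen_lex_product G F =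
     \<lparr>pverts = (\<Union>i \<in> pverts G. pverts (F i)),
      parcs = (\<Union>i \<in> pverts G. parcs (F i)) \<union>
        {(x, y). \<exists>i j. (i, j) \<in> parcs G \<and> x \<in> pverts (F i) \<and> y \<in> pverts (F j)}\<rparr>"

definition gamma_excellent :: "'h pair_pre_digraph \<Rightarrow> 'a pair_pre_digraph \<Rightarrow> bool" where
  "gamma_excellent H X \<longleftrightarrow>
     (\<forall>x \<in> pverts X. \<exists>Hx :: 'a pair_pre_digraph.
        induced_subgraph (with_proj Hx) (with_proj X) \<and>
        digraph_iso (with_proj Hx) (with_proj H) \<and>
        x \<in> pverts Hx \<and> (\<exists>D. gamma_set X D \<and> pverts Hx \<subseteq> D)) \<and>
     (\<forall>H' :: 'a pair_pre_digraph.
        induced_subgraph (with_proj H') (with_proj X) \<and>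
        digraph_iso (with_proj H') (with_proj H) \<longrightarrow>
        (\<exists>D. gamma_set X D \<and> pverts H' \<subseteq> D))"

lemma pair_graph_gen_lex_product:
  assumes G: "pair_graph G" and F: "\<And>i. i \<in> pverts G \<Longrightarrow> pair_graph (F i)"
    and disj: "disjoint_family_on (\<lambda>i. pverts (F i)) (pverts G)"
  shows "pair_graph (gen_lex_product G F)"
proof -
  interpret G: pair_graph G by (rule G)
  have factor: "u \<in> pverts (F i) \<and> v \<in> pverts (F i) \<and> u \<noteq> v \<and> (v, u) \<in> parcs (F i)"
    if "i \<in> pverts G" "(u, v) \<in> parcs (F i)" for i u v
  proof -
    interpret Fi: pair_graph "F i" by (rule F[OF that(1)])
    show ?thesis
      using that(2) Fi.in_arcsD1 Fi.in_arcsD2 Fi.pair_no_loops Fi.graph_symmetric by fastforce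
  qed
  have cross: "i \<in> pverts G \<and> j \<in> pverts G \<and> u \<noteq> v \<and> (j, i) \<in> parcs G"
    if "(i, j) \<in> parcs G" "u \<in> pverts (F i)" "v \<in> pverts (F j)" for i j u v
  proof -
    have "i \<in> pverts G" "j \<in> pverts G" "i \<noteq> j" "(j, i) \<in> parcs G"
      using that(1) G.in_arcsD1 G.in_arcsD2 G.pair_no_loops G.graph_symmetric by fastforce+
    then show ?thesis using that disj by (auto simp: disjoint_family_on_def)
  qed
  have arc: "u \<in> pverts (gen_lex_product G F) \<and> v \<in> pverts (gen_lex_product G F) \<and> u \<noteq> v \<and>
      (v, u) \<in> parcs (gen_lex_product G F)" if "(u, v) \<in> parcs (gen_lex_product G F)" for u v
  proof -
    from that consider i where "i \<in> pverts G" "(u, v) \<in> parcs (F i)"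
      | i j where "(i, j) \<in> parcs G" "u \<in> pverts (F i)" "v \<in> pverts (F j)"
      by (auto simp: gen_lex_product_def)
    then show ?thesis
    proof cases
      case 1
      then show ?thesis using factor[OF 1] by (auto simp: gen_lex_product_def)
    next
      case 2
      then show ?thesis using cross[OF 2] by (auto simp: gen_lex_product_def)
    qed
  qed
  have "finite (pverts (F i))" if "i \<in> pverts G" for i
  proof -
    interpret Fi: pair_graph "F i" by (rule F[OF that])
    show ?thesis by (rule Fi.pair_finite_verts)
  qed
  then have fin: "finite (pverts (gen_lex_product G F))"
    using G.pair_finite_verts by (simp add: gen_lex_product_def)
  have "parcs (gen_lex_product G F) \<subseteq> pverts (gen_lex_product G F) \<times> pverts (gen_lex_product G F)"
    using arc by auto
  then have fin': "finite (parcs (gen_lex_product G F))"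
    using fin by (meson finite_SigmaI finite_subset)
  have sym: "symmetric (with_proj (gen_lex_product G F))"
    using arc by (auto simp: symmetric_def intro: symI)
  have ends: "fst e \<in> pverts (gen_lex_product G F) \<and> snd e \<in> pverts (gen_lex_product G F) \<and> fst e \<noteq> snd e"
    if "e \<in> parcs (gen_lex_product G F)" for e
    using arc[of "fst e" "snd e"] that by simp
  show ?thesis
    by unfold_locales (simp_all add: fin fin' sym ends)
qed

lemma induced_subgraph_gen_lex_product:
  assumes G: "pair_graph G" and F: "\<And>i. i \<in> pverts G \<Longrightarrow> pair_graph (F i)"
    and disj: "disjoint_family_on (\<lambda>i. pverts (F i)) (pverts G)" and i: "i \<in> pverts G"
  shows "induced_subgraph (with_proj (F i)) (with_proj (gen_lex_product G F))"
proof -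
  interpret G: pair_graph G by (rule G)
  interpret P: pair_graph "gen_lex_product G F" by (rule pair_graph_gen_lex_product[OF G F disj])
  interpret Fi: pair_graph "F i" by (rule F[OF i])
  have uniq: "j = i" if "j \<in> pverts G" "x \<in> pverts (F j)" "x \<in> pverts (F i)" for j x
    using that i disj by (auto simp: disjoint_family_on_def)
  have "e \<in> parcs (F i)"
    if e: "e \<in> parcs (gen_lex_product G F)" "fst e \<in> pverts (F i)" "snd e \<in> pverts (F i)" for e
  proof -
    have "e \<in> parcs (F i)" if j: "j \<in> pverts G" "e \<in> parcs (F j)" for j
    proof -
      interpret Fj: pair_graph "F j" by (rule F[OF j(1)])
      show ?thesis
        using uniq[OF j(1) Fj.arc_fst_in_verts[OF j(2)] e(2)] j(2) by simp
    qed
    moreover have False if "(j, k) \<in> parcs G" "fst e \<in> pverts (F j)" "snd e \<in> pverts (F k)" for j k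
    proof -
      have "j = i" "k = i"
        using that uniq e(2,3) G.in_arcsD1 G.in_arcsD2 by blast+
      then show False using that(1) G.pair_no_loops[of "(i, i)"] by simp
    qed
    ultimately show ?thesis using e(1) by (cases e) (auto simp: gen_lex_product_def)
  qed
  moreover have "pverts (F i) \<subseteq> pverts (gen_lex_product G F)" "parcs (F i) \<subseteq> parcs (gen_lex_product G F)"
    using i by (auto simp: gen_lex_product_def)
  ultimately show ?thesis
    using P.wf_digraph Fi.wf_digraph
    by (auto simp: induced_subgraph_def subgraph_def Fi.arc_fst_in_verts Fi.arc_snd_in_verts
        dest: Fi.in_arcsD1 Fi.in_arcsD2)
qed

end

theory Submission
  imports Defs
begin

text \<open>
  Contracting every factor \<open>F k\<close> to the vertex \<open>k\<close> is a map \<open>p\<close> from \<open>G[F]\<close> onto \<open>G\<close>.  Since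
  the factors are complete, two distinct vertices of \<open>G[F]\<close> are adjacent exactly if their
  images under \<open>p\<close> are equal or adjacent; that is, \<open>G[F]\<close> arises from \<open>G\<close> by replacing each
  vertex with a clique of closed twins.  The proof uses nothing about \<open>G[F]\<close> beyond this map.

  Closed twins dominate the same vertices, so a vertex set \<open>D\<close> dominates \<open>G[F]\<close> if and only if
  \<open>p ` D\<close> dominates \<open>G\<close> (\<open>dominating_set_iff_image\<close>).  A smallest such \<open>D\<close> cannot waste vertices
  on twins, so the \<open>\<gamma>\<close>-sets of \<open>G[F]\<close> are precisely the sets that \<open>p\<close> maps injectively onto a
  \<open>\<gamma>\<close>-set of \<open>G\<close> (\<open>gamma_set_iff_image\<close>).  Independent sets do not contain two twins either, and
  are likewise the sets that \<open>p\<close> maps injectively onto an independent set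
  (\<open>independent_iff_image\<close>).  Therefore the configurations that excellence speaks of, an
  independent \<open>s\<close>-set inside a \<open>\<gamma>\<close>-set, can be pushed down along \<open>p\<close>, and can be lifted
  back by choosing one vertex in each fibre.  The choice can be made to extend any partial
  choice made before (\<open>extend_transversal\<close>), which is what keeps a prescribed vertex or a
  prescribed independent set inside the lift.
\<close>

section \<open>Excellence with respect to edgeless graphs\<close>

definition independent_in :: "'a pair_pre_digraph \<Rightarrow> 'a set \<Rightarrow> bool" where
  "independent_in X S \<longleftrightarrow> S \<subseteq> pverts X \<and> (\<forall>u \<in> S. \<forall>v \<in> S. (u, v) \<notin> parcs X)"

lemma digraph_iso_edgeless_graph_iff:
  "digraph_iso (with_proj H) (with_proj (edgeless_graph s)) \<longleftrightarrow>
     parcs H = {} \<and> finite (pverts H) \<and> card (pverts H) = s"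
proof
  assume "digraph_iso (with_proj H) (with_proj (edgeless_graph s))"
  then obtain f where "pre_digraph.digraph_isomorphism (with_proj H) f"
    and eq: "with_proj (edgeless_graph s) = app_iso f (with_proj H)"
    by (auto simp: digraph_iso_def)
  then have inj: "inj_on (iso_verts f) (pverts H)"
    by (simp add: pre_digraph.digraph_isomorphism_def)
  have "iso_verts f ` pverts H = {1..s}" "iso_arcs f ` parcs H = {}"
    using arg_cong[OF eq, of verts] arg_cong[OF eq, of arcs] by (auto simp: edgeless_graph_def)
  with inj show "parcs H = {} \<and> finite (pverts H) \<and> card (pverts H) = s"
    using finite_imageD[OF _ inj] card_image[OF inj] by simp
next
  assume H: "parcs H = {} \<and> finite (pverts H) \<and> card (pverts H) = s"
  then obtain h where h: "bij_betw h (pverts H) {1..s}"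
    by (metis card_atLeastAtMost diff_Suc_1 finite_atLeastAtMost finite_same_card_bij)
  \<comment> \<open>Isomorphic digraphs must agree in their tail and head maps even where there are no arcs,
     so these maps have to be \<open>fst\<close> and \<open>snd\<close>.\<close>
  define f :: "('a, 'a \<times> 'a, nat, nat \<times> nat) digraph_isomorphism"
    where "f = \<lparr>iso_verts = h, iso_arcs = map_prod h h, iso_head = snd, iso_tail = fst\<rparr>"
  have "wf_digraph (with_proj H)"
    using H by unfold_locales auto
  then have "pre_digraph.digraph_isomorphism (with_proj H) f"
    using H h by (simp add: pre_digraph.digraph_isomorphism_def f_def bij_betw_def)
  moreover have "with_proj (edgeless_graph s) = app_iso f (with_proj H)"
    using H h by (simp add: app_iso_def with_proj_def edgeless_graph_def f_def bij_betw_def)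
  ultimately show "digraph_iso (with_proj H) (with_proj (edgeless_graph s))"
    by (auto simp: digraph_iso_def)
qed

context pair_graph
begin

lemma edgeless_induced_subgraph_iff:
  "induced_subgraph (with_proj H) (with_proj G) \<and>
     digraph_iso (with_proj H) (with_proj (edgeless_graph s)) \<longleftrightarrow>
   parcs H = {} \<and> independent_in G (pverts H) \<and> card (pverts H) = s"
proof -
  have "induced_subgraph (with_proj H) (with_proj G) \<longleftrightarrow> independent_in G (pverts H)"
    if "parcs H = {}"
  proof -
    have "wf_digraph (with_proj H)"
      using that by unfold_locales auto
    then show ?thesis
      using that wf_digraph
      by (auto simp: induced_subgraph_def subgraph_def compatible_def independent_in_def)
  qed
  moreover have "finite (pverts H)" if "independent_in G (pverts H)"
    using that pair_finite_verts by (auto simp: independent_in_def intro: finite_subset)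
  ultimately show ?thesis
    by (auto simp: digraph_iso_edgeless_graph_iff)
qed

text \<open>An edgeless subgraph is determined by its vertex set, so that excellence for
  \<open>edgeless_graph s\<close> becomes a statement about independent sets only.\<close>

lemma gamma_excellent_edgeless_iff:
  "gamma_excellent (edgeless_graph s) G \<longleftrightarrow>
     (\<forall>x \<in> pverts G. \<exists>S D. independent_in G S \<and> card S = s \<and> x \<in> S \<and> gamma_set G D \<and> S \<subseteq> D) \<and>
     (\<forall>S. independent_in G S \<and> card S = s \<longrightarrow> (\<exists>D. gamma_set G D \<and> S \<subseteq> D))"
proof -
  have ex: "(\<exists>H :: 'a pair_pre_digraph. parcs H = {} \<and> Q (pverts H)) \<longleftrightarrow> (\<exists>S. Q S)" for Q
    by (metis pair_pre_digraph.select_convs)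
  have all: "(\<forall>H :: 'a pair_pre_digraph. parcs H = {} \<and> P (pverts H) \<longrightarrow> Q (pverts H)) \<longleftrightarrow>
      (\<forall>S. P S \<longrightarrow> Q S)" for P Q
    by (metis pair_pre_digraph.select_convs)
  have "gamma_excellent (edgeless_graph s) G \<longleftrightarrow>
     (\<forall>x \<in> pverts G. \<exists>H :: 'a pair_pre_digraph. parcs H = {} \<and> independent_in G (pverts H) \<and> card (pverts H) = s
        \<and> x \<in> pverts H \<and> (\<exists>D. gamma_set G D \<and> pverts H \<subseteq> D)) \<and>
     (\<forall>H :: 'a pair_pre_digraph. parcs H = {} \<and> independent_in G (pverts H) \<and> card (pverts H) = s \<longrightarrow>
        (\<exists>D. gamma_set G D \<and> pverts H \<subseteq> D))"
    by (simp only: gamma_excellent_def edgeless_induced_subgraph_iff conj_assoc[symmetric])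
  also have "\<dots> \<longleftrightarrow>
     (\<forall>x \<in> pverts G. \<exists>S. independent_in G S \<and> card S = s \<and> x \<in> S \<and> (\<exists>D. gamma_set G D \<and> S \<subseteq> D)) \<and>
     (\<forall>S. independent_in G S \<and> card S = s \<longrightarrow> (\<exists>D. gamma_set G D \<and> S \<subseteq> D))"
    unfolding
      ex[of "\<lambda>S. independent_in G S \<and> card S = s \<and> x \<in> S \<and> (\<exists>D. gamma_set G D \<and> S \<subseteq> D)" for x]
      all[of "\<lambda>S. independent_in G S \<and> card S = s" "\<lambda>S. \<exists>D. gamma_set G D \<and> S \<subseteq> D"] ..
  finally show ?thesis
    by simp
qed

end

lemma domination_number_le:
  "dominating_set X D \<Longrightarrow> domination_number X \<le> card D"
  unfolding domination_number_def by (rule Least_le) auto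

lemma ex_gamma_set: "\<exists>D. gamma_set X D"
proof -
  have "dominating_set X (pverts X)"
    by (simp add: dominating_set_def)
  then have "\<exists>k D. dominating_set X D \<and> card D = k"
    by blast
  then show ?thesis
    unfolding gamma_set_def domination_number_def by (rule LeastI_ex)
qed

section \<open>Replacing vertices by cliques of closed twins\<close>

locale clique_expansion =
  X: pair_graph X + Y: pair_graph Y
  for X :: "'a pair_pre_digraph" and Y :: "'b pair_pre_digraph" +
  fixes p :: "'a \<Rightarrow> 'b"
  assumes surj: "p ` pverts X = pverts Y"
    and arc_iff: "\<lbrakk>x \<in> pverts X; y \<in> pverts X\<rbrakk> \<Longrightarrow>
      (x, y) \<in> parcs X \<longleftrightarrow> x \<noteq> y \<and> (p x = p y \<or> (p x, p y) \<in> parcs Y)"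
begin

lemma vertex_image: "x \<in> pverts X \<Longrightarrow> p x \<in> pverts Y"
  using surj by auto

lemma fibre_nonempty:
  assumes "y \<in> pverts Y"
  obtains x where "x \<in> pverts X" "p x = y"
  using assms surj by (metis imageE)

text \<open>Every partial choice of at most one vertex per fibre extends to a choice of exactly
  one vertex in each fibre over \<open>D\<close>: keep \<open>S\<close>, and add a vertex only in those
  fibres that \<open>S\<close> does not meet.\<close>

lemma extend_transversal:
  assumes "S \<subseteq> pverts X" "inj_on p S" "p ` S \<subseteq> D" "D \<subseteq> pverts Y"
  obtains T where "S \<subseteq> T" "T \<subseteq> pverts X" "inj_on p T" "p ` T = D"
proof
  define c where "c = inv_into (pverts X) p"
  let ?T = "S \<union> c ` (D - p ` S)"
  have c: "c y \<in> pverts X" "p (c y) = y" if "y \<in> D" for y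
    using that assms(4) surj inv_into_into[of y p] f_inv_into_f[of y p] unfolding c_def by auto
  show "S \<subseteq> ?T" by blast
  show "?T \<subseteq> pverts X" using assms(1) c by auto
  have img: "p ` c ` (D - p ` S) = D - p ` S"
    using c(2) by (simp add: image_image)
  have "inj_on p (c ` (D - p ` S))"
    by (rule inj_onI) (use c(2) in auto)
  moreover have "p ` (S - c ` (D - p ` S)) \<inter> p ` (c ` (D - p ` S) - S) = {}"
    using img by blast
  ultimately show "inj_on p ?T"
    using assms(2) by (simp only: inj_on_Un)
  show "p ` ?T = D"
    using assms(3) by (auto simp only: image_Un img)
qed

lemma independent_iff_image:
  assumes "S \<subseteq> pverts X"
  shows "independent_in X S \<longleftrightarrow> inj_on p S \<and> independent_in Y (p ` S)"
proof -
  have arc: "(x, y) \<in> parcs X \<longleftrightarrow> x \<noteq> y \<and> (p x = p y \<or> (p x, p y) \<in> parcs Y)"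
    if "x \<in> S" "y \<in> S" for x y
    using that assms arc_iff by blast
  have noloop: "(z, z) \<notin> parcs Y" for z
    using Y.pair_no_loops by fastforce
  have "p ` S \<subseteq> pverts Y"
    using assms vertex_image by auto
  then have "independent_in Y (p ` S) \<longleftrightarrow> (\<forall>x \<in> S. \<forall>y \<in> S. (p x, p y) \<notin> parcs Y)"
    by (simp add: independent_in_def)
  moreover have "independent_in X S \<longleftrightarrow> (\<forall>x \<in> S. \<forall>y \<in> S. (x, y) \<notin> parcs X)"
    using assms by (simp add: independent_in_def)
  ultimately show ?thesis
    unfolding inj_on_def using arc noloop by metis
qed

text \<open>Where \<open>D\<close> misses a vertex \<open>v\<close> but meets the fibre of \<open>v\<close>, it contains a twin
  of \<open>v\<close>, which dominates \<open>v\<close>; this is where the completeness of the fibres enters.\<close>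

lemma dominating_set_iff_image:
  assumes "D \<subseteq> pverts X"
  shows "dominating_set X D \<longleftrightarrow> dominating_set Y (p ` D)"
proof
  assume dom: "dominating_set X D"
  have "\<exists>u \<in> p ` D. (u, w) \<in> parcs Y" if w: "w \<in> pverts Y - p ` D" for w
  proof -
    obtain v where v: "v \<in> pverts X" "p v = w"
      using w fibre_nonempty by blast
    with w have "v \<notin> D"
      by blast
    with v obtain u where "u \<in> D" "(u, v) \<in> parcs X"
      using dom by (auto simp: dominating_set_def)
    then have u: "p u \<in> p ` D" "u \<in> pverts X"
      using assms by auto
    moreover have "p u \<noteq> p v"
    proof
      assume "p u = p v"
      with u(1) v w show False by simp
    qed
    ultimately have "(p u, p v) \<in> parcs Y"
      using \<open>(u, v) \<in> parcs X\<close> v arc_iff by simp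
    then show ?thesis
      using \<open>u \<in> D\<close> v by auto
  qed
  moreover have "p ` D \<subseteq> pverts Y"
    using assms vertex_image by auto
  ultimately show "dominating_set Y (p ` D)"
    by (simp add: dominating_set_def)
next
  assume dom: "dominating_set Y (p ` D)"
  have "\<exists>u \<in> D. (u, v) \<in> parcs X" if v: "v \<in> pverts X - D" for v
  proof -
    obtain u where u: "u \<in> D" "p u = p v \<or> (p u, p v) \<in> parcs Y"
    proof (cases "p v \<in> p ` D")
      case True
      then show thesis using that by fastforce
    next
      case False
      then have "p v \<in> pverts Y - p ` D"
        using v vertex_image by simp
      then obtain w where "w \<in> p ` D" "(w, p v) \<in> parcs Y"
        using dom unfolding dominating_set_def by blast
      then show thesis using that by auto
    qed
    moreover have "u \<noteq> v" "u \<in> pverts X"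
      using u v assms by auto
    ultimately show ?thesis
      using v arc_iff by auto
  qed
  then show "dominating_set X D"
    using assms by (auto simp: dominating_set_def)
qed

lemma finite_if_subset_verts: "D \<subseteq> pverts X \<Longrightarrow> finite D"
  using X.pair_finite_verts finite_subset by blast

lemma domination_number_eq: "domination_number X = domination_number Y"
proof (rule antisym)
  obtain A where A: "gamma_set Y A"
    using ex_gamma_set by blast
  then have "A \<subseteq> pverts Y"
    by (simp add: gamma_set_def dominating_set_def)
  then obtain T where T: "T \<subseteq> pverts X" "inj_on p T" "p ` T = A"
    using extend_transversal[of "{}" A] by auto
  then have "dominating_set X T"
    using A dominating_set_iff_image by (simp add: gamma_set_def)
  moreover have "card T = domination_number Y"
    using A T by (metis card_image gamma_set_def)
  ultimately show "domination_number X \<le> domination_number Y"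
    using domination_number_le by metis
next
  obtain D where D: "gamma_set X D"
    using ex_gamma_set by blast
  then have sub: "D \<subseteq> pverts X"
    by (simp add: gamma_set_def dominating_set_def)
  then have "domination_number Y \<le> card (p ` D)"
    using D dominating_set_iff_image domination_number_le by (metis gamma_set_def)
  also have "\<dots> \<le> card D"
    using finite_if_subset_verts[OF sub] by (rule card_image_le)
  finally show "domination_number Y \<le> domination_number X"
    using D by (simp add: gamma_set_def)
qed

text \<open>Injectivity is a matter of counting: \<open>p ` D\<close> dominates \<open>Y\<close>, hence has at least
  as many elements as the \<open>\<gamma>\<close>-set \<open>D\<close>, the two domination numbers being equal.\<close>

lemma gamma_set_iff_image:
  assumes "D \<subseteq> pverts X"
  shows "gamma_set X D \<longleftrightarrow> inj_on p D \<and> gamma_set Y (p ` D)"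
proof
  assume D: "gamma_set X D"
  then have dom: "dominating_set Y (p ` D)"
    using dominating_set_iff_image[OF assms] by (simp add: gamma_set_def)
  have "card D \<le> card (p ` D)"
    using D domination_number_le[OF dom] by (simp add: gamma_set_def domination_number_eq)
  then have "card (p ` D) = card D"
    using card_image_le[OF finite_if_subset_verts[OF assms], of p] by simp
  then show "inj_on p D \<and> gamma_set Y (p ` D)"
    using D dom eq_card_imp_inj_on[OF finite_if_subset_verts[OF assms]]
    by (simp add: gamma_set_def domination_number_eq)
next
  assume "inj_on p D \<and> gamma_set Y (p ` D)"
  then show "gamma_set X D"
    using dominating_set_iff_image[OF assms] card_image[of p D]
    by (auto simp: gamma_set_def domination_number_eq)
qed

lemma independent_image:
  assumes "independent_in X S"
  shows "independent_in Y (p ` S)" "card (p ` S) = card S"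
proof -
  have "S \<subseteq> pverts X"
    using assms by (simp add: independent_in_def)
  then have "inj_on p S \<and> independent_in Y (p ` S)"
    using assms independent_iff_image by simp
  then show "independent_in Y (p ` S)" "card (p ` S) = card S"
    by (simp_all add: card_image)
qed

lemma gamma_set_image: "gamma_set X D \<Longrightarrow> gamma_set Y (p ` D)"
  using gamma_set_iff_image[of D] by (auto simp: gamma_set_def dominating_set_def)

text \<open>The set \<open>R\<close> holds vertices that the lift must contain: a single prescribed vertex for
  the first clause of excellence, none for the second.\<close>

lemma lift_independent:
  assumes "R \<subseteq> pverts X" "inj_on p R" "p ` R \<subseteq> S" "independent_in Y S"
  obtains T where "R \<subseteq> T" "p ` T = S" "independent_in X T" "card T = card S"
proof -
  have "S \<subseteq> pverts Y"
    using assms(4) by (simp add: independent_in_def)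
  then obtain T where T: "R \<subseteq> T" "T \<subseteq> pverts X" "inj_on p T" "p ` T = S"
    using extend_transversal[OF assms(1-3)] by blast
  then show thesis
    using that[of T] assms(4) independent_iff_image[of T] card_image[of p T] by simp
qed

lemma lift_gamma_set:
  assumes "independent_in X S" "p ` S \<subseteq> D" "gamma_set Y D"
  obtains E where "S \<subseteq> E" "gamma_set X E"
proof -
  have S: "S \<subseteq> pverts X"
    using assms(1) by (simp add: independent_in_def)
  have D: "D \<subseteq> pverts Y"
    using assms(3) by (simp add: gamma_set_def dominating_set_def)
  obtain E where "S \<subseteq> E" "E \<subseteq> pverts X" "inj_on p E" "p ` E = D"
    using extend_transversal[OF S _ assms(2) D] assms(1) independent_iff_image[OF S] by blast
  then show thesis
    using that[of E] assms(3) gamma_set_iff_image[of E] by simp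
qed

theorem gamma_excellent_edgeless_cong:
  "gamma_excellent (edgeless_graph s) X \<longleftrightarrow> gamma_excellent (edgeless_graph s) Y"
proof
  assume "gamma_excellent (edgeless_graph s) X"
  then have
    point: "\<And>x. x \<in> pverts X \<Longrightarrow>
      \<exists>S D. independent_in X S \<and> card S = s \<and> x \<in> S \<and> gamma_set X D \<and> S \<subseteq> D" and
    set: "\<And>S. independent_in X S \<Longrightarrow> card S = s \<Longrightarrow> \<exists>D. gamma_set X D \<and> S \<subseteq> D"
    by (auto simp: X.gamma_excellent_edgeless_iff)
  have "\<exists>S D. independent_in Y S \<and> card S = s \<and> y \<in> S \<and> gamma_set Y D \<and> S \<subseteq> D"
    if "y \<in> pverts Y" for y
  proof -
    obtain x where "x \<in> pverts X" "p x = y"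
      using \<open>y \<in> pverts Y\<close> fibre_nonempty by blast
    then obtain S D where "independent_in X S" "card S = s" "x \<in> S" "gamma_set X D" "S \<subseteq> D"
      using point by blast
    then show ?thesis
      using independent_image[of S] gamma_set_image[of D] \<open>p x = y\<close> by blast
  qed
  moreover have "\<exists>D. gamma_set Y D \<and> S \<subseteq> D" if S: "independent_in Y S" "card S = s" for S
  proof -
    obtain T where T: "p ` T = S" "independent_in X T" "card T = s"
      using lift_independent[of "{}" S] S by auto
    then obtain D where "gamma_set X D" "T \<subseteq> D"
      using set by blast
    then show ?thesis
      using gamma_set_image T by blast
  qed
  ultimately show "gamma_excellent (edgeless_graph s) Y"
    by (auto simp: Y.gamma_excellent_edgeless_iff)
next
  assume "gamma_excellent (edgeless_graph s) Y"
  then have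
    point: "\<And>y. y \<in> pverts Y \<Longrightarrow>
      \<exists>S D. independent_in Y S \<and> card S = s \<and> y \<in> S \<and> gamma_set Y D \<and> S \<subseteq> D" and
    set: "\<And>S. independent_in Y S \<Longrightarrow> card S = s \<Longrightarrow> \<exists>D. gamma_set Y D \<and> S \<subseteq> D"
    by (auto simp: Y.gamma_excellent_edgeless_iff)
  have "\<exists>S D. independent_in X S \<and> card S = s \<and> x \<in> S \<and> gamma_set X D \<and> S \<subseteq> D"
    if "x \<in> pverts X" for x
  proof -
    obtain S D where S: "independent_in Y S" "card S = s" "p x \<in> S" and D: "gamma_set Y D" "S \<subseteq> D"
      using point[OF vertex_image[OF \<open>x \<in> pverts X\<close>]] by blast
    obtain T where T: "x \<in> T" "p ` T = S" "independent_in X T" "card T = s"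
      using lift_independent[of "{x}" S] S \<open>x \<in> pverts X\<close> by auto
    then obtain E where "T \<subseteq> E" "gamma_set X E"
      using lift_gamma_set D by metis
    then show ?thesis
      using T by blast
  qed
  moreover have "\<exists>D. gamma_set X D \<and> S \<subseteq> D" if "independent_in X S" "card S = s" for S
    using independent_image[OF that(1)] that set lift_gamma_set by metis
  ultimately show "gamma_excellent (edgeless_graph s) X"
    by (auto simp: X.gamma_excellent_edgeless_iff)
qed

end

section \<open>Generalized lexicographic products with complete factors\<close>

text \<open>The witnessing map sends a vertex to the index of its factor, which is unique by
  disjointness; nonempty factors make it surjective.\<close>

lemma clique_expansion_gen_lex_product:
  assumes G: "pair_graph G" and F: "\<And>i. i \<in> pverts G \<Longrightarrow> pair_graph (F i)"
    and disj: "disjoint_family_on (\<lambda>i. pverts (F i)) (pverts G)"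
    and complete: "\<And>i. i \<in> pverts G \<Longrightarrow>
      complete_digraph (card (pverts (F i))) (with_proj (F i))"
    and nonempty: "\<And>i. i \<in> pverts G \<Longrightarrow> pverts (F i) \<noteq> {}"
  shows "clique_expansion (gen_lex_product G F) G
    (\<lambda>x. THE i. i \<in> pverts G \<and> x \<in> pverts (F i))" (is "clique_expansion ?P G ?p")
proof -
  interpret G: pair_graph G by (rule G)
  interpret P: pair_graph ?P by (rule pair_graph_gen_lex_product[OF G F disj])
  have verts: "pverts ?P = (\<Union>i \<in> pverts G. pverts (F i))"
    by (simp add: gen_lex_product_def)
  have index: "?p x = i" if "i \<in> pverts G" "x \<in> pverts (F i)" for i x
    using that disj by (intro the_equality) (auto simp: disjoint_family_on_def)
  have factor: "(x, y) \<in> parcs (F i) \<longleftrightarrow> x \<in> pverts (F i) \<and> y \<in> pverts (F i) \<and> x \<noteq> y"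
    if "i \<in> pverts G" for i x y
    using complete[OF that] by (auto simp: complete_digraph_pair_def)
  show ?thesis
  proof unfold_locales
    show "?p ` pverts ?P = pverts G"
    proof (intro equalityI subsetI)
      fix y assume "y \<in> ?p ` pverts ?P"
      then show "y \<in> pverts G" using index by (auto simp: verts)
    next
      fix i assume i: "i \<in> pverts G"
      then obtain x where "x \<in> pverts (F i)" using nonempty by blast
      with i show "i \<in> ?p ` pverts ?P"
        using index by (intro rev_image_eqI[of x]) (auto simp: verts)
    qed
  next
    fix x y assume "x \<in> pverts ?P" "y \<in> pverts ?P"
    then obtain i j where i: "i \<in> pverts G" "x \<in> pverts (F i)"
      and j: "j \<in> pverts G" "y \<in> pverts (F j)"
      by (auto simp: verts)
    have uniq: "k = i" if "k \<in> pverts G" "x \<in> pverts (F k)" for k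
      using index[OF that] index[OF i] by simp
    have uniq': "k = j" if "k \<in> pverts G" "y \<in> pverts (F k)" for k
      using index[OF that] index[OF j] by simp
    have "(x, y) \<in> parcs ?P \<longleftrightarrow> (\<exists>k \<in> pverts G. (x, y) \<in> parcs (F k)) \<or>
        (\<exists>k l. (k, l) \<in> parcs G \<and> x \<in> pverts (F k) \<and> y \<in> pverts (F l))"
      by (auto simp: gen_lex_product_def)
    also have "(\<exists>k \<in> pverts G. (x, y) \<in> parcs (F k)) \<longleftrightarrow> i = j \<and> x \<noteq> y"
      using i j uniq uniq' factor by metis
    also have "(\<exists>k l. (k, l) \<in> parcs G \<and> x \<in> pverts (F k) \<and> y \<in> pverts (F l)) \<longleftrightarrow> (i, j) \<in> parcs G"
      using i j uniq uniq' G.in_arcsD1 G.in_arcsD2 by metis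
    also have "i = j \<and> x \<noteq> y \<or> (i, j) \<in> parcs G \<longleftrightarrow> x \<noteq> y \<and> (i = j \<or> (i, j) \<in> parcs G)"
      using i uniq' G.pair_no_loops by fastforce
    finally show "(x, y) \<in> parcs ?P \<longleftrightarrow> x \<noteq> y \<and> (?p x = ?p y \<or> (?p x, ?p y) \<in> parcs G)"
      by (simp only: index[OF i] index[OF j])
  qed
qed

theorem theorem15:
  fixes n s :: nat
    and G :: "nat pair_pre_digraph"
    and F :: "nat \<Rightarrow> 'a pair_pre_digraph"
  assumes "pair_graph G" and "pverts G = {1..n}" and "n \<ge> 2"
    and "Digraph_Component.connected (with_proj G)"
    and "\<And>k. k \<in> {1..n} \<Longrightarrow> pair_graph (F k)"
    and "disjoint_family_on (\<lambda>k. pverts (F k)) {1..n}"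
    and "\<And>k. k \<in> {1..n} \<Longrightarrow> complete_digraph (card (pverts (F k))) (with_proj (F k))"
    and "\<And>k. k \<in> {1..n} \<Longrightarrow> card (pverts (F k)) \<ge> 2"
    and "s \<ge> 1"
  shows "gamma_excellent (edgeless_graph s) (gen_lex_product G F) \<longleftrightarrow>
         gamma_excellent (edgeless_graph s) G"
proof (rule clique_expansion.gamma_excellent_edgeless_cong, rule clique_expansion_gen_lex_product)
  fix i assume "i \<in> pverts G"
  then show "pverts (F i) \<noteq> {}"
    using assms(2) assms(8)[of i] by auto
qed (use assms in auto)

end
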